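(* Let $\{X_{n,p}\}$, $\{Y_{n,p}\}$ and $\{X_p\}$ be real-valued random variables indexed by positive integers $n,p$, with $X_{n,p}$ and $Y_{n,p}$ defined on a common probability space for each $n,p$, and let $\{c_p\}$ be a bounded sequence of real numbers. Assume that the collection of distributions of $\{X_p\}$ on $\mathbb{R}$ is relatively compact with respect to the total variation metric. Suppose that $X_{n,p}\Longrightarrow X_p$ uniformly-over-$p$ and $Y_{n,p}\stackrel{\mathrm{P}}{\longrightarrow}c_p$ uniformly-over-$p$. Then: (a) $X_{n,p}+Y_{n,p}\Longrightarrow X_p+c_p$ uniformly-over-$p$; (b) $X_{n,p}Y_{n,p}\Longrightarrow c_pX_p$ uniformly-over-$p$; (c) $X_{n,p}/Y_{n,p}\Longrightarrow X_p/c_p$ uniformly-over-$p$ if $\{c_p\}$ is bounded away from $0$, i.e., $\inf_p|c_p|>0$.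
   Context: The indices $n$ and $p$ range over the positive integers. For random variables $V_{n,p}$ and $V_p$ with distributions $\mu_{n,p}$ and $\mu_p$ on $\mathbb{R}$, $V_{n,p}\Longrightarrow V_p$ uniformly-over-$p$ means that for every bounded continuous function $f:\mathbb{R}\to\mathbb{R}$, $\lim_{n\to\infty}\sup_p\left|\int f\,\mathrm{d}\mu_{n,p}-\int f\,\mathrm{d}\mu_p\right|=0$. The notation $Y_{n,p}\stackrel{\mathrm{P}}{\longrightarrow}c_p$ uniformly-over-$p$ means that for every $\epsilon>0$, $\lim_{n\to\infty}\sup_p\mathrm{P}[|Y_{n,p}-c_p|>\epsilon]=0$. A collection $\{\mu_p\}$ of probability measures on $\mathbb{R}$ is relatively compact with respect to the total variation metric if every sequence $\{\mu_{p_n}\}$ in it has a subsequence $\{\mu_{p_{n_k}}\}$ such that $\sup_{C}|\mu_{p_{n_k}}(C)-\nu(C)|\to 0$ as $k\to\infty$ (supremum over Borel sets $C\subset\mathbb{R}$) for some probability measure $\nu$ on $\mathbb{R}$ ($\nu$ need not belong to the collection). In (c), the quotient $X_{n,p}/Y_{n,p}$ may be assigned any fixed real value on the event $\{Y_{n,p}=0\}$. *)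

theory Defs
  imports "HOL-Probability.Probability"
begin

text \<open>The indices range over the positive integers, represented as the set \<^term>\<open>{1..} :: nat set\<close>;
  values at index 0 play no role. All suprema below are taken in \<^typ>\<open>real\<close>: for probability
  measures (and bounded \<open>f\<close>) they are suprema of nonempty bounded sets.\<close>

definition weak_conv_unif ::
  "(nat \<Rightarrow> nat \<Rightarrow> real measure) \<Rightarrow> (nat \<Rightarrow> real measure) \<Rightarrow> bool" where
  "weak_conv_unif \<mu> \<nu> \<longleftrightarrow>
    (\<forall>f :: real \<Rightarrow> real. continuous_on UNIV f \<and> bounded (range f) \<longrightarrow>
      (\<lambda>n. SUP p\<in>{1..}. \<bar>(LINT x|\<mu> n p. f x) - (LINT x|\<nu> p. f x)\<bar>) \<longlonglongrightarrow> 0)"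

definition conv_in_prob_unif ::
  "(nat \<Rightarrow> nat \<Rightarrow> 'a measure) \<Rightarrow> (nat \<Rightarrow> nat \<Rightarrow> 'a \<Rightarrow> real) \<Rightarrow> (nat \<Rightarrow> real) \<Rightarrow> bool" where
  "conv_in_prob_unif M Y c \<longleftrightarrow>
    (\<forall>\<epsilon>>0. (\<lambda>n. SUP p\<in>{1..}.
        measure (M n p) {\<omega> \<in> space (M n p). \<bar>Y n p \<omega> - c p\<bar> > \<epsilon>}) \<longlonglongrightarrow> 0)"

definition tv_dist :: "real measure \<Rightarrow> real measure \<Rightarrow> real" where
  "tv_dist \<mu> \<nu> = (SUP C\<in>sets borel. \<bar>measure \<mu> C - measure \<nu> C\<bar>)"

text \<open>The limit \<open>\<nu>\<close> need not belong to the collection \<open>A\<close>.\<close>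

definition tv_relatively_compact :: "real measure set \<Rightarrow> bool" where
  "tv_relatively_compact A \<longleftrightarrow>
    (\<forall>\<mu> :: nat \<Rightarrow> real measure. (\<forall>n. \<mu> n \<in> A) \<longrightarrow>
      (\<exists>r \<nu>. strict_mono r \<and> real_distribution \<nu> \<and> (\<lambda>k. tv_dist (\<mu> (r k)) \<nu>) \<longlonglongrightarrow> 0))"

end

theory Submission
  imports Defs
begin

text \<open>All three parts are instances of one mapping theorem: if \<open>g\<close> is continuous on
  \<open>\<real> \<times> S\<close>, where the compact set \<open>S\<close> contains a uniform neighbourhood of every \<open>c\<^sub>p\<close>, then
  \<open>g(X\<^sub>n\<^sub>p, Y\<^sub>n\<^sub>p) \<Longrightarrow> g(X\<^sub>p, c\<^sub>p)\<close> uniformly over \<open>p\<close>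
  (\<open>weak_conv_unif_continuous_map\<close>). A pointwise-in-\<open>p\<close> Slutsky argument does not suffice,
  because the test function \<open>x \<mapsto> f (g x c\<^sub>p)\<close> changes with \<open>p\<close>, whereas the hypothesis gives
  uniformity in \<open>p\<close> only for one fixed test function.

  Compactness reduces this family of test functions to finitely many. The laws of the \<open>X\<^sub>p\<close>
  are tight, since total variation limits of them are single laws and so have small tails
  (\<open>tv_relatively_compact_imp_tight\<close>); comparing with a continuous cutoff, the \<open>X\<^sub>n\<^sub>p\<close> are
  eventually tight as well (\<open>weak_conv_unif_tail\<close>). So up to a small probability everything
  happens on a compact rectangle \<open>[-T, T] \<times> S\<close>, where \<open>h = f \<circ> g\<close> is uniformly continuous.
  Choose a finite net among the \<open>c\<^sub>p\<close> and let \<open>a\<close> be a net point close to \<open>c\<^sub>p\<close>. Then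
  \<open>h(X\<^sub>n\<^sub>p, Y\<^sub>n\<^sub>p) \<approx> h(X\<^sub>n\<^sub>p, a)\<close> and \<open>h(X\<^sub>p, c\<^sub>p) \<approx> h(X\<^sub>p, a)\<close> off small events, and the
  expectations of \<open>h(X\<^sub>n\<^sub>p, a)\<close> and \<open>h(X\<^sub>p, a)\<close> are close uniformly in \<open>p\<close> because only
  finitely many \<open>a\<close> occur.\<close>

section \<open>Uniform limits without suprema\<close>

lemma SUP_tendsto_0_iff:
  fixes F :: "nat \<Rightarrow> nat \<Rightarrow> real"
  assumes nonneg: "\<And>n p. n \<ge> 1 \<Longrightarrow> p \<ge> 1 \<Longrightarrow> 0 \<le> F n p"
    and bound: "\<And>n p. n \<ge> 1 \<Longrightarrow> p \<ge> 1 \<Longrightarrow> F n p \<le> B"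
  shows "(\<lambda>n. SUP p\<in>{1..}. F n p) \<longlonglongrightarrow> 0 \<longleftrightarrow>
    (\<forall>e>0. \<forall>\<^sub>F n in sequentially. \<forall>p\<ge>1. F n p < e)"
proof -
  have upper: "F n p \<le> (SUP p\<in>{1..}. F n p)" if "n \<ge> 1" "p \<ge> 1" for n p
    using that bound[OF that(1)] by (intro cSUP_upper bdd_aboveI2[where M=B]) auto
  have SUP_nonneg: "0 \<le> (SUP p\<in>{1..}. F n p)" if "n \<ge> 1" for n
    using nonneg[OF that, of 1] upper[OF that, of 1] by simp
  show ?thesis
  proof (intro iffI allI impI)
    fix e :: real
    assume "(\<lambda>n. SUP p\<in>{1..}. F n p) \<longlonglongrightarrow> 0" "e > 0"
    then have "\<forall>\<^sub>F n in sequentially. (SUP p\<in>{1..}. F n p) < e"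
      by (rule order_tendstoD)
    with eventually_ge_at_top[of 1] show "\<forall>\<^sub>F n in sequentially. \<forall>p\<ge>1. F n p < e"
      by eventually_elim (meson upper le_less_trans)
  next
    assume small: "\<forall>e>0. \<forall>\<^sub>F n in sequentially. \<forall>p\<ge>1. F n p < e"
    show "(\<lambda>n. SUP p\<in>{1..}. F n p) \<longlonglongrightarrow> 0"
    proof (rule tendstoI)
      fix e :: real
      assume "e > 0"
      then have "\<forall>\<^sub>F n in sequentially. \<forall>p\<ge>1. F n p < e / 2"
        using small[rule_format, of "e / 2"] by simp
      with eventually_ge_at_top[of 1]
      show "\<forall>\<^sub>F n in sequentially. dist (SUP p\<in>{1..}. F n p) 0 < e"
      proof eventually_elim
        case (elim n)
        then have "(SUP p\<in>{1..}. F n p) \<le> e / 2"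
          by (intro cSUP_least) (auto intro: less_imp_le)
        with SUP_nonneg[OF elim(1)] \<open>e > 0\<close> show ?case
          by simp
      qed
    qed
  qed
qed

lemma (in prob_space) abs_expectation_le_bound:
  fixes U :: "'a \<Rightarrow> real"
  assumes "U \<in> borel_measurable M" "\<And>x. \<bar>U x\<bar> \<le> B"
  shows "integrable M U" "\<bar>expectation U\<bar> \<le> B"
proof -
  show int: "integrable M U"
    using assms by (intro integrable_const_bound[where B=B]) auto
  have "expectation U \<le> B" "expectation U \<ge> - B"
    using int assms(2) by (auto intro!: integral_le_const integral_ge_const simp: abs_le_iff minus_le_iff)
  then show "\<bar>expectation U\<bar> \<le> B"
    by linarith
qed

lemma (in prob_space) expectation_close_off_event:
  fixes U V :: "'a \<Rightarrow> real"
  assumes [measurable]: "U \<in> borel_measurable M" "V \<in> borel_measurable M" "A \<in> events"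
    and B: "\<And>x. \<bar>U x\<bar> \<le> B" "\<And>x. \<bar>V x\<bar> \<le> B"
    and close: "\<And>x. x \<in> space M \<Longrightarrow> x \<notin> A \<Longrightarrow> \<bar>U x - V x\<bar> \<le> e" and "0 \<le> e"
  shows "\<bar>expectation U - expectation V\<bar> \<le> e + 2 * B * prob A"
proof -
  have int: "integrable M U" "integrable M V"
    using abs_expectation_le_bound(1)[OF assms(1) B(1)] abs_expectation_le_bound(1)[OF assms(2) B(2)] .
  have intA: "integrable M (\<lambda>x. e + 2 * B * indicator A x)"
    by (intro Bochner_Integration.integrable_add integrable_mult_right integrable_real_indicator)
      (auto simp: less_top[symmetric])
  have "\<bar>expectation U - expectation V\<bar> = \<bar>expectation (\<lambda>x. U x - V x)\<bar>"
    using int by simp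
  also have "\<dots> \<le> expectation (\<lambda>x. \<bar>U x - V x\<bar>)"
    by (rule integral_abs_bound)
  also have "\<dots> \<le> expectation (\<lambda>x. e + 2 * B * indicator A x)"
  proof (rule integral_mono[OF _ intA])
    show "integrable M (\<lambda>x. \<bar>U x - V x\<bar>)"
      using int by (intro integrable_abs Bochner_Integration.integrable_diff) auto
    fix x assume "x \<in> space M"
    then show "\<bar>U x - V x\<bar> \<le> e + 2 * B * indicator A x"
      using close[of x] B(1)[of x] B(2)[of x] \<open>0 \<le> e\<close> by (cases "x \<in> A") (auto simp: abs_le_iff)
  qed
  also have "\<dots> = e + 2 * B * prob A"
    by (subst Bochner_Integration.integral_add) (auto simp: prob_space less_top[symmetric])
  finally show ?thesis .
qed

lemma weak_conv_unif_iff: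
  assumes "\<And>n p. n \<ge> 1 \<Longrightarrow> p \<ge> 1 \<Longrightarrow> real_distribution (\<mu> n p)"
    and "\<And>p. p \<ge> 1 \<Longrightarrow> real_distribution (\<nu> p)"
  shows "weak_conv_unif \<mu> \<nu> \<longleftrightarrow>
    (\<forall>f :: real \<Rightarrow> real. continuous_on UNIV f \<and> bounded (range f) \<longrightarrow>
      (\<forall>e>0. \<forall>\<^sub>F n in sequentially. \<forall>p\<ge>1. \<bar>(LINT x|\<mu> n p. f x) - (LINT x|\<nu> p. f x)\<bar> < e))"
proof -
  have "(\<lambda>n. SUP p\<in>{1..}. \<bar>(LINT x|\<mu> n p. f x) - (LINT x|\<nu> p. f x)\<bar>) \<longlonglongrightarrow> 0 \<longleftrightarrow>
      (\<forall>e>0. \<forall>\<^sub>F n in sequentially. \<forall>p\<ge>1. \<bar>(LINT x|\<mu> n p. f x) - (LINT x|\<nu> p. f x)\<bar> < e)"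
    if f: "continuous_on UNIV f" "bounded (range f)" for f :: "real \<Rightarrow> real"
  proof -
    obtain B where B: "\<And>x. \<bar>f x\<bar> \<le> B"
      using f(2) by (auto simp: bounded_iff)
    have int: "\<bar>LINT x|\<kappa>. f x\<bar> \<le> B" if "real_distribution \<kappa>" for \<kappa>
    proof -
      interpret real_distribution \<kappa> by fact
      have "f \<in> borel_measurable \<kappa>"
        using borel_measurable_continuous_onI[OF f(1)] by simp
      then show ?thesis
        using B by (rule abs_expectation_le_bound)
    qed
    have "\<bar>(LINT x|\<mu> n p. f x) - (LINT x|\<nu> p. f x)\<bar> \<le> 2 * B" if "n \<ge> 1" "p \<ge> 1" for n p
      using int[OF assms(1)[OF that]] int[OF assms(2)[OF that(2)]] by linarith
    then show ?thesis
      by (intro SUP_tendsto_0_iff) auto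
  qed
  then show ?thesis
    unfolding weak_conv_unif_def by blast
qed

lemma weak_conv_unif_cong_limit:
  assumes "\<And>p. p \<ge> 1 \<Longrightarrow> \<nu> p = \<nu>' p"
  shows "weak_conv_unif \<mu> \<nu> \<longleftrightarrow> weak_conv_unif \<mu> \<nu>'"
proof -
  have "(\<lambda>p. \<bar>(LINT x|\<mu> n p. f x) - (LINT x|\<nu> p. f x)\<bar>) ` {1..} =
      (\<lambda>p. \<bar>(LINT x|\<mu> n p. f x) - (LINT x|\<nu>' p. f x)\<bar>) ` {1..}" for n and f :: "real \<Rightarrow> real"
    using assms by (intro image_cong) auto
  then show ?thesis
    unfolding weak_conv_unif_def by (simp only:)
qed

section \<open>Tightness\<close>

lemma measure_diff_le_tv_dist:
  assumes "real_distribution \<mu>" "real_distribution \<nu>" "C \<in> sets borel"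
  shows "\<bar>measure \<mu> C - measure \<nu> C\<bar> \<le> tv_dist \<mu> \<nu>"
proof -
  interpret \<mu>: real_distribution \<mu> by fact
  interpret \<nu>: real_distribution \<nu> by fact
  have "\<bar>measure \<mu> D - measure \<nu> D\<bar> \<le> 1" for D
    using \<mu>.prob_le_1[of D] \<nu>.prob_le_1[of D] measure_nonneg[of \<mu> D] measure_nonneg[of \<nu> D]
    by linarith
  then show ?thesis
    unfolding tv_dist_def using assms(3) by (intro cSUP_upper bdd_aboveI2[where M=1]) auto
qed

lemma real_distribution_tail:
  assumes "real_distribution \<nu>" "0 < e"
  shows "\<exists>k::nat. measure \<nu> {x. \<bar>x\<bar> > real k} < e"
proof -
  interpret real_distribution \<nu> by fact
  have "(\<lambda>k. prob {x. \<bar>x\<bar> > real k}) \<longlonglongrightarrow> prob (\<Inter>k. {x. \<bar>x\<bar> > real k})"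
    by (intro finite_Lim_measure_decseq) (auto simp: decseq_def)
  moreover have "x \<notin> (\<Inter>k. {x. \<bar>x\<bar> > real k})" for x :: real
    using real_arch_simple[of "\<bar>x\<bar>"] by (auto simp: not_less)
  then have "(\<Inter>k. {x::real. \<bar>x\<bar> > real k}) = {}"
    by blast
  ultimately have "(\<lambda>k. prob {x. \<bar>x\<bar> > real k}) \<longlonglongrightarrow> 0"
    by simp
  then have "\<forall>\<^sub>F k in sequentially. prob {x. \<bar>x\<bar> > real k} < e"
    using \<open>0 < e\<close> by (rule order_tendstoD)
  then show ?thesis
    by (auto simp: eventually_sequentially)
qed

text \<open>If for every \<open>k\<close> some law \<open>\<mu>\<^sub>k\<close> in \<open>A\<close> had mass at least \<open>e\<close> beyond \<open>k\<close>, then a limit of a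
  subsequence of the \<open>\<mu>\<^sub>k\<close> would have mass at least \<open>e\<close> beyond every point.\<close>

lemma tv_relatively_compact_imp_tight:
  assumes A: "tv_relatively_compact A" "\<And>\<mu>. \<mu> \<in> A \<Longrightarrow> real_distribution \<mu>"
    and "0 < e"
  shows "\<exists>T. \<forall>\<mu>\<in>A. measure \<mu> {x. \<bar>x\<bar> > T} < e"
proof (rule ccontr)
  assume "\<not> ?thesis"
  then have "\<forall>k::nat. \<exists>\<mu>\<in>A. e \<le> measure \<mu> {x. \<bar>x\<bar> > real k}"
    by (auto simp: not_less)
  then obtain \<mu> where \<mu>: "\<And>k. \<mu> k \<in> A" "\<And>k. e \<le> measure (\<mu> k) {x. \<bar>x\<bar> > real k}"
    by metis
  then obtain r \<nu> where r: "strict_mono r" and \<nu>: "real_distribution \<nu>"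
    and lim: "(\<lambda>k. tv_dist (\<mu> (r k)) \<nu>) \<longlonglongrightarrow> 0"
    using A(1) unfolding tv_relatively_compact_def by blast
  obtain m :: nat where m: "measure \<nu> {x. \<bar>x\<bar> > real m} < e / 2"
    using real_distribution_tail[OF \<nu>, of "e / 2"] \<open>0 < e\<close> by auto
  have "\<forall>\<^sub>F k in sequentially. tv_dist (\<mu> (r k)) \<nu> < e / 2 \<and> k \<ge> m"
    using order_tendstoD(2)[OF lim, of "e / 2"] \<open>0 < e\<close>
    by (intro eventually_conj eventually_ge_at_top) simp
  then obtain k where k: "tv_dist (\<mu> (r k)) \<nu> < e / 2" "k \<ge> m"
    by (auto simp: eventually_sequentially)
  have dist_k: "real_distribution (\<mu> (r k))"
    using \<mu>(1) A(2) by blast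
  interpret real_distribution "\<mu> (r k)" by (rule dist_k)
  have "m \<le> r k"
    using k(2) seq_suble[OF r, of k] by simp
  then have "e \<le> prob {x. \<bar>x\<bar> > real m}"
    by (intro order.trans[OF \<mu>(2)[of "r k"]] finite_measure_mono) auto
  moreover have "\<bar>prob {x. \<bar>x\<bar> > real m} - measure \<nu> {x. \<bar>x\<bar> > real m}\<bar> \<le> tv_dist (\<mu> (r k)) \<nu>"
    by (intro measure_diff_le_tv_dist dist_k \<nu>) measurable
  ultimately show False
    using m k(1) by linarith
qed

text \<open>A tail indicator is not a continuous test function, but the ramp rising from \<open>0\<close> to \<open>1\<close>
  on \<open>T \<le> \<bar>x\<bar> \<le> T + 1\<close> separates the tails beyond \<open>T\<close> and \<open>T + 1\<close>.\<close>

lemma weak_conv_unif_tail: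
  assumes \<mu>: "\<And>n p. n \<ge> 1 \<Longrightarrow> p \<ge> 1 \<Longrightarrow> real_distribution (\<mu> n p)"
    and \<nu>: "\<And>p. p \<ge> 1 \<Longrightarrow> real_distribution (\<nu> p)"
    and conv: "weak_conv_unif \<mu> \<nu>"
    and tail: "\<And>p. p \<ge> 1 \<Longrightarrow> measure (\<nu> p) {x. \<bar>x\<bar> > T} < e" and "e < e'"
  shows "\<forall>\<^sub>F n in sequentially. \<forall>p\<ge>1. measure (\<mu> n p) {x. \<bar>x\<bar> > T + 1} < e'"
proof -
  define \<phi> where "\<phi> x = min 1 (max 0 (\<bar>x\<bar> - T))" for x :: real
  have \<phi>: "continuous_on UNIV \<phi>" "bounded (range \<phi>)" "\<And>x. \<bar>\<phi> x\<bar> \<le> 1"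
    unfolding \<phi>_def by (auto intro!: continuous_intros boundedI[where B=1])
  have [measurable]: "\<phi> \<in> borel_measurable borel"
    using \<phi>(1) by (rule borel_measurable_continuous_onI)
  have ramp: "measure \<kappa> {x. \<bar>x\<bar> > T + 1} \<le> (LINT x|\<kappa>. \<phi> x) \<and>
      (LINT x|\<kappa>. \<phi> x) \<le> measure \<kappa> {x. \<bar>x\<bar> > T}" if "real_distribution \<kappa>" for \<kappa>
  proof -
    interpret real_distribution \<kappa> by fact
    have int: "integrable \<kappa> \<phi>"
      using \<phi>(3) by (intro abs_expectation_le_bound) simp_all
    have "expectation (indicator {x. \<bar>x\<bar> > T + 1}) \<le> expectation \<phi>"
      by (intro integral_mono int) (auto simp: \<phi>_def less_top[symmetric] split: split_indicator)
    moreover have "expectation \<phi> \<le> expectation (indicator {x. \<bar>x\<bar> > T})"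
      by (intro integral_mono int) (auto simp: \<phi>_def less_top[symmetric] split: split_indicator)
    ultimately show ?thesis
      by simp
  qed
  have "\<forall>\<^sub>F n in sequentially. \<forall>p\<ge>1. \<bar>(LINT x|\<mu> n p. \<phi> x) - (LINT x|\<nu> p. \<phi> x)\<bar> < e' - e"
    using conv \<phi>(1,2) \<open>e < e'\<close> unfolding weak_conv_unif_iff[of \<mu> \<nu>, OF \<mu> \<nu>, simplified] by simp
  with eventually_ge_at_top[of 1] show ?thesis
  proof eventually_elim
    case (elim n)
    show ?case
    proof (intro allI impI)
      fix p :: nat
      assume "p \<ge> 1"
      with elim have "\<bar>(LINT x|\<mu> n p. \<phi> x) - (LINT x|\<nu> p. \<phi> x)\<bar> < e' - e"
        by blast
      then show "measure (\<mu> n p) {x. \<bar>x\<bar> > T + 1} < e'"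
        using ramp[OF \<mu>[OF elim(1) \<open>p \<ge> 1\<close>]] ramp[OF \<nu>[OF \<open>p \<ge> 1\<close>]] tail[OF \<open>p \<ge> 1\<close>] by linarith
    qed
  qed
qed

section \<open>Uniform continuous mapping\<close>

text \<open>The radius \<open>\<rho>\<close> keeps \<open>Y\<^sub>n\<^sub>p\<close> inside \<open>S\<close> whenever it is close to \<open>c\<^sub>p\<close>; outside
  \<open>\<real> \<times> S\<close> the map \<open>g\<close> may be discontinuous, as division is at \<open>0\<close>.\<close>

lemma weak_conv_unif_continuous_map:
  fixes M :: "nat \<Rightarrow> nat \<Rightarrow> 'a measure" and N :: "nat \<Rightarrow> 'b measure"
    and g :: "real \<Rightarrow> real \<Rightarrow> real"
  assumes M: "\<And>n p. n \<ge> 1 \<Longrightarrow> p \<ge> 1 \<Longrightarrow> prob_space (M n p)"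
    and X: "\<And>n p. n \<ge> 1 \<Longrightarrow> p \<ge> 1 \<Longrightarrow> X n p \<in> borel_measurable (M n p)"
    and Y: "\<And>n p. n \<ge> 1 \<Longrightarrow> p \<ge> 1 \<Longrightarrow> Y n p \<in> borel_measurable (M n p)"
    and N: "\<And>p. p \<ge> 1 \<Longrightarrow> prob_space (N p)"
    and L: "\<And>p. p \<ge> 1 \<Longrightarrow> L p \<in> borel_measurable (N p)"
    and compact: "tv_relatively_compact ((\<lambda>p. distr (N p) borel (L p)) ` {1..})"
    and convX: "weak_conv_unif (\<lambda>n p. distr (M n p) borel (X n p)) (\<lambda>p. distr (N p) borel (L p))"
    and convY: "conv_in_prob_unif M Y c"
    and S: "compact S" "0 < \<rho>" "\<And>p y. p \<ge> 1 \<Longrightarrow> \<bar>y - c p\<bar> \<le> \<rho> \<Longrightarrow> y \<in> S"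
    and g_meas: "(\<lambda>(x, y). g x y) \<in> borel_measurable (borel \<Otimes>\<^sub>M borel)"
    and g_cont: "continuous_on (UNIV \<times> S) (\<lambda>(x, y). g x y)"
  shows "weak_conv_unif (\<lambda>n p. distr (M n p) borel (\<lambda>\<omega>. g (X n p \<omega>) (Y n p \<omega>)))
           (\<lambda>p. distr (N p) borel (\<lambda>\<omega>. g (L p \<omega>) (c p)))"
proof -
  let ?\<mu> = "\<lambda>n p. distr (M n p) borel (X n p)" and ?\<nu> = "\<lambda>p. distr (N p) borel (L p)"
  have gXY: "(\<lambda>\<omega>. g (U \<omega>) (V \<omega>)) \<in> borel_measurable K"
    if "U \<in> borel_measurable K" "V \<in> borel_measurable K" for K :: "'k measure" and U V
    using measurable_compose[OF measurable_Pair[OF that] g_meas] by simp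
  have \<mu>: "real_distribution (?\<mu> n p)" if "n \<ge> 1" "p \<ge> 1" for n p
    using prob_space.real_distribution_distr[OF M[OF that] X[OF that]] .
  have \<nu>: "real_distribution (?\<nu> p)" if "p \<ge> 1" for p
    using prob_space.real_distribution_distr[OF N[OF that] L[OF that]] .
  have \<mu>g: "real_distribution (distr (M n p) borel (\<lambda>\<omega>. g (X n p \<omega>) (Y n p \<omega>)))"
    if "n \<ge> 1" "p \<ge> 1" for n p
    by (intro prob_space.real_distribution_distr M gXY X Y that)
  have \<nu>g: "real_distribution (distr (N p) borel (\<lambda>\<omega>. g (L p \<omega>) (c p)))" if "p \<ge> 1" for p
    by (intro prob_space.real_distribution_distr N gXY L that borel_measurable_const)
  have cS: "c ` {1..} \<subseteq> S"
    using S(2,3) by auto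
  have probY: "\<forall>\<^sub>F n in sequentially. \<forall>p\<ge>1.
      measure (M n p) {\<omega> \<in> space (M n p). \<bar>Y n p \<omega> - c p\<bar> > \<delta>} < e" if "0 < \<delta>" "0 < e" for \<delta> e
  proof -
    have "(\<lambda>n. SUP p\<in>{1..}.
        measure (M n p) {\<omega> \<in> space (M n p). \<bar>Y n p \<omega> - c p\<bar> > \<delta>}) \<longlonglongrightarrow> 0"
      using convY \<open>0 < \<delta>\<close> unfolding conv_in_prob_unif_def by blast
    then show ?thesis
      using M \<open>0 < e\<close> by (subst (asm) SUP_tendsto_0_iff[where B=1]) (auto intro: prob_space.prob_le_1)
  qed
  have "\<forall>\<^sub>F n in sequentially. \<forall>p\<ge>1.
      \<bar>(LINT x|distr (M n p) borel (\<lambda>\<omega>. g (X n p \<omega>) (Y n p \<omega>)). f x)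
        - (LINT x|distr (N p) borel (\<lambda>\<omega>. g (L p \<omega>) (c p)). f x)\<bar> < e"
    if f: "continuous_on UNIV f" "bounded (range f)" and "0 < e" for f :: "real \<Rightarrow> real" and e
  proof -
    obtain B0 where "\<And>x. \<bar>f x\<bar> \<le> B0"
      using f(2) by (auto simp: bounded_iff)
    then obtain B where B: "\<And>x. \<bar>f x\<bar> \<le> B" and "0 < B"
      using that[of "max B0 1"] by (auto simp: le_max_iff_disj)
    have f_meas [measurable]: "f \<in> borel_measurable borel"
      using f(1) by (rule borel_measurable_continuous_onI)
    define h where "h x y = f (g x y)" for x y
    have h_meas: "(\<lambda>\<omega>. h (U \<omega>) (V \<omega>)) \<in> borel_measurable K"
      if "U \<in> borel_measurable K" "V \<in> borel_measurable K" for K :: "'k measure" and U V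
      unfolding h_def by (intro measurable_compose[OF gXY[OF that] f_meas])
    have h_cont: "continuous_on (UNIV \<times> S) (\<lambda>(x, y). h x y)"
      unfolding h_def case_prod_beta
      by (rule continuous_on_compose2[OF f(1)]) (use g_cont in \<open>auto simp: case_prod_beta\<close>)
    have hB: "\<bar>h x y\<bar> \<le> B" for x y
      unfolding h_def by (rule B)

    \<comment> \<open>Total error below: three terms of size \<open>e / 8\<close>, plus \<open>2 * B\<close> times three exceptional
      probabilities, each less than \<open>\<eta>\<close>.\<close>
    define \<eta> where "\<eta> = e / (16 * B)"
    have "0 < \<eta>" and \<eta>: "2 * B * \<eta> = e / 8"
      using \<open>0 < B\<close> \<open>0 < e\<close> by (simp_all add: \<eta>_def)
    obtain T where "\<forall>\<kappa>\<in>?\<nu> ` {1..}. measure \<kappa> {x. \<bar>x\<bar> > T} < \<eta> / 2"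
      using tv_relatively_compact_imp_tight[OF compact, of "\<eta> / 2"] \<nu> \<open>0 < \<eta>\<close> by auto
    then have T: "measure (?\<nu> p) {x. \<bar>x\<bar> > T} < \<eta> / 2" if "p \<ge> 1" for p
      using that by auto
    have tailX: "\<forall>\<^sub>F n in sequentially. \<forall>p\<ge>1. measure (?\<mu> n p) {x. \<bar>x\<bar> > T + 1} < \<eta>"
      using \<mu> \<nu> convX T \<open>0 < \<eta>\<close>
      by (intro weak_conv_unif_tail[where \<nu>="?\<nu>" and e="\<eta> / 2"]) auto
    have tailL: "measure (?\<nu> p) {x. \<bar>x\<bar> > T + 1} < \<eta>" if "p \<ge> 1" for p
    proof -
      interpret real_distribution "?\<nu> p" using that by (rule \<nu>)
      have "prob {x. \<bar>x\<bar> > T + 1} \<le> prob {x. \<bar>x\<bar> > T}"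
        by (intro finite_measure_mono) auto
      then show ?thesis
        using T[OF that] \<open>0 < \<eta>\<close> by linarith
    qed

    have "compact ({- (T + 1)..T + 1} \<times> S)"
      using S(1) by (intro compact_Times) auto
    then have "uniformly_continuous_on ({- (T + 1)..T + 1} \<times> S) (\<lambda>(x, y). h x y)"
      by (intro compact_uniformly_continuous continuous_on_subset[OF h_cont]) auto
    then obtain \<delta> where "0 < \<delta>"
      and \<delta>: "\<And>z z'. z \<in> {- (T + 1)..T + 1} \<times> S \<Longrightarrow> z' \<in> {- (T + 1)..T + 1} \<times> S \<Longrightarrow>
        dist z' z < \<delta> \<Longrightarrow> dist (case z' of (x, y) \<Rightarrow> h x y) (case z of (x, y) \<Rightarrow> h x y) < e / 8"
      unfolding uniformly_continuous_on_def using \<open>0 < e\<close>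
      by (elim allE[of _ "e / 8"]) auto
    have h_close: "\<bar>h x y - h x a\<bar> \<le> e / 8"
      if "\<bar>x\<bar> \<le> T + 1" "y \<in> S" "a \<in> S" "\<bar>y - a\<bar> < \<delta>" for x y a
    proof -
      have "x \<in> {- (T + 1)..T + 1}"
        using that(1) by auto
      then show ?thesis
        using \<delta>[of "(x, a)" "(x, y)"] that by (simp add: dist_Pair_Pair dist_real_def)
    qed
    \<comment> \<open>If \<open>Y\<^sub>n\<^sub>p\<close> is within \<open>\<delta>'\<close> of \<open>c\<^sub>p\<close>, it lies in \<open>S\<close> and within \<open>\<delta>\<close> of any point that is
      \<open>\<delta> / 2\<close>-close to \<open>c\<^sub>p\<close>.\<close>
    define \<delta>' where "\<delta>' = min \<rho> (\<delta> / 2)"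
    have "0 < \<delta>'" "\<delta>' \<le> \<rho>" "\<delta>' \<le> \<delta> / 2"
      using \<open>0 < \<rho>\<close> \<open>0 < \<delta>\<close> by (auto simp: \<delta>'_def)

    obtain D where D: "finite D" "D \<subseteq> c ` {1..}" "c ` {1..} \<subseteq> (\<Union>a\<in>D. ball a (\<delta> / 2))"
    proof -
      have "compact (closure (c ` {1..}))"
        using S(1) cS bounded_subset compact_imp_bounded by (auto simp: compact_closure)
      moreover have "closure (c ` {1..}) \<subseteq> (\<Union>a\<in>c ` {1..}. ball a (\<delta> / 2))"
      proof
        fix y assume "y \<in> closure (c ` {1..})"
        then obtain a where "a \<in> c ` {1..}" "dist a y < \<delta> / 2"
          using \<open>0 < \<delta>\<close> unfolding closure_approachable by (meson half_gt_zero)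
        then show "y \<in> (\<Union>a\<in>c ` {1..}. ball a (\<delta> / 2))"
          by (auto simp del: image_iff)
      qed
      ultimately obtain D where "D \<subseteq> c ` {1..}" "finite D"
          "closure (c ` {1..}) \<subseteq> (\<Union>a\<in>D. ball a (\<delta> / 2))"
        by (rule compactE_image[OF _ open_ball])
      with closure_subset[of "c ` {1..}"] show thesis
        by (intro that) (simp_all only:, blast)
    qed
    have "\<forall>\<^sub>F n in sequentially. \<forall>p\<ge>1. \<bar>(LINT x|?\<mu> n p. h x a) - (LINT x|?\<nu> p. h x a)\<bar> < e / 8"
      if "a \<in> D" for a
    proof -
      have "a \<in> S"
        using D(2) cS that by blast
      then have "continuous_on UNIV (\<lambda>x. h x a)"
        by (intro continuous_on_compose2[OF h_cont, of _ "\<lambda>x. (x, a)", simplified])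
          (auto intro!: continuous_intros)
      moreover have "bounded (range (\<lambda>x. h x a))"
        using hB by (auto intro!: boundedI[where B=B])
      ultimately show ?thesis
        using convX[unfolded weak_conv_unif_iff[of ?\<mu> ?\<nu>, OF \<mu> \<nu>, simplified],
            rule_format, of "\<lambda>x. h x a" "e / 8"] \<open>0 < e\<close> by simp
    qed
    then have "\<forall>\<^sub>F n in sequentially. \<forall>a\<in>D. \<forall>p\<ge>1.
        \<bar>(LINT x|?\<mu> n p. h x a) - (LINT x|?\<nu> p. h x a)\<bar> < e / 8"
      using D(1) by (intro eventually_ball_finite) auto
    with eventually_ge_at_top[of 1] tailX probY[OF \<open>0 < \<delta>'\<close> \<open>0 < \<eta>\<close>] show ?thesis
    proof eventually_elim
      case (elim n)
      show ?case
      proof (intro allI impI)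
        fix p :: nat
        assume p: "p \<ge> 1"
        note [measurable] = X[OF elim(1) p] Y[OF elim(1) p] L[OF p]
        interpret M: prob_space "M n p" by (rule M[OF elim(1) p])
        interpret N: prob_space "N p" by (rule N[OF p])
        obtain a where a: "a \<in> D" "\<bar>c p - a\<bar> < \<delta> / 2"
          using D(3) p by (force simp: dist_real_def abs_minus_commute)
        have "a \<in> S" "c p \<in> S"
          using D(2) cS a(1) p by auto

        define E where "E = {\<omega> \<in> space (M n p). \<bar>X n p \<omega>\<bar> > T + 1} \<union>
          {\<omega> \<in> space (M n p). \<bar>Y n p \<omega> - c p\<bar> > \<delta>'}"
        have [measurable]: "E \<in> sets (M n p)"
          unfolding E_def by measurable
        have "M.prob E \<le> M.prob {\<omega> \<in> space (M n p). \<bar>X n p \<omega>\<bar> > T + 1} +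
            M.prob {\<omega> \<in> space (M n p). \<bar>Y n p \<omega> - c p\<bar> > \<delta>'}"
          unfolding E_def by (intro measure_Un_le) measurable
        also have "M.prob {\<omega> \<in> space (M n p). \<bar>X n p \<omega>\<bar> > T + 1} =
            measure (?\<mu> n p) {x. \<bar>x\<bar> > T + 1}"
          by (subst measure_distr) (auto intro!: arg_cong[where f=M.prob])
        finally have probE: "M.prob E \<le> 2 * \<eta>"
          using elim(2,3) p by fastforce
        have XY: "\<bar>M.expectation (\<lambda>\<omega>. h (X n p \<omega>) (Y n p \<omega>)) - M.expectation (\<lambda>\<omega>. h (X n p \<omega>) a)\<bar>
            \<le> e / 8 + 2 * B * M.prob E"
        proof (intro M.expectation_close_off_event h_meas hB)
          fix \<omega> assume "\<omega> \<in> space (M n p)" "\<omega> \<notin> E"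
          then have "\<bar>X n p \<omega>\<bar> \<le> T + 1" "\<bar>Y n p \<omega> - c p\<bar> \<le> \<delta>'"
            by (auto simp: E_def)
          moreover from this have "Y n p \<omega> \<in> S"
            using \<open>\<delta>' \<le> \<rho>\<close> by (intro S(3)[OF p]) simp
          ultimately show "\<bar>h (X n p \<omega>) (Y n p \<omega>) - h (X n p \<omega>) a\<bar> \<le> e / 8"
            using \<open>\<delta>' \<le> \<delta> / 2\<close> a(2) \<open>a \<in> S\<close> by (intro h_close; linarith)
        qed (use \<open>0 < e\<close> in auto)

        define F where "F = {\<omega> \<in> space (N p). \<bar>L p \<omega>\<bar> > T + 1}"
        have [measurable]: "F \<in> sets (N p)"
          unfolding F_def by measurable
        have "N.prob F = measure (?\<nu> p) {x. \<bar>x\<bar> > T + 1}"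
          unfolding F_def by (subst measure_distr) (auto intro!: arg_cong[where f=N.prob])
        then have probF: "N.prob F \<le> \<eta>"
          using tailL[OF p] by simp
        have Lc: "\<bar>N.expectation (\<lambda>\<omega>. h (L p \<omega>) (c p)) - N.expectation (\<lambda>\<omega>. h (L p \<omega>) a)\<bar>
            \<le> e / 8 + 2 * B * N.prob F"
        proof (intro N.expectation_close_off_event h_meas hB)
          fix \<omega> assume "\<omega> \<in> space (N p)" "\<omega> \<notin> F"
          then show "\<bar>h (L p \<omega>) (c p) - h (L p \<omega>) a\<bar> \<le> e / 8"
            using a(2) \<open>a \<in> S\<close> \<open>c p \<in> S\<close> \<open>0 < \<delta>\<close> by (intro h_close) (auto simp: F_def)
        qed (use \<open>0 < e\<close> in auto)

        have ha: "(\<lambda>x. h x a) \<in> borel_measurable borel"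
          by (intro h_meas) auto
        have "\<bar>M.expectation (\<lambda>\<omega>. h (X n p \<omega>) a) - N.expectation (\<lambda>\<omega>. h (L p \<omega>) a)\<bar> < e / 8"
          using elim(4)[rule_format, OF a(1) p]
          unfolding integral_distr[OF X[OF elim(1) p] ha] integral_distr[OF L[OF p] ha] .
        moreover have "2 * B * M.prob E \<le> 2 * B * (2 * \<eta>)" "2 * B * N.prob F \<le> 2 * B * \<eta>"
          using probE probF \<open>0 < B\<close> by (intro mult_left_mono; linarith)+
        then have "2 * B * M.prob E \<le> 2 * (e / 8)" "2 * B * N.prob F \<le> e / 8"
          using \<eta> by linarith+
        ultimately have
          "\<bar>M.expectation (\<lambda>\<omega>. h (X n p \<omega>) (Y n p \<omega>)) - N.expectation (\<lambda>\<omega>. h (L p \<omega>) (c p))\<bar> < e"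
          using XY Lc \<open>0 < e\<close> by linarith
        then show "\<bar>(LINT x|distr (M n p) borel (\<lambda>\<omega>. g (X n p \<omega>) (Y n p \<omega>)). f x)
            - (LINT x|distr (N p) borel (\<lambda>\<omega>. g (L p \<omega>) (c p)). f x)\<bar> < e"
          unfolding h_def integral_distr[OF gXY[OF X[OF elim(1) p] Y[OF elim(1) p]] f_meas]
            integral_distr[OF gXY[OF L[OF p] borel_measurable_const] f_meas] .
      qed
    qed
  qed
  then show ?thesis
    using \<mu>g \<nu>g by (subst weak_conv_unif_iff) auto
qed

section \<open>Sums, products and quotients\<close>

theorem theorem8:
  fixes M :: "nat \<Rightarrow> nat \<Rightarrow> 'a measure"
    and N :: "nat \<Rightarrow> 'b measure"
    and X Y :: "nat \<Rightarrow> nat \<Rightarrow> 'a \<Rightarrow> real"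
    and X_lim :: "nat \<Rightarrow> 'b \<Rightarrow> real"
    and c :: "nat \<Rightarrow> real"
  assumes "\<And>n p. n \<ge> 1 \<Longrightarrow> p \<ge> 1 \<Longrightarrow> prob_space (M n p)"
    and "\<And>n p. n \<ge> 1 \<Longrightarrow> p \<ge> 1 \<Longrightarrow> X n p \<in> borel_measurable (M n p)"
    and "\<And>n p. n \<ge> 1 \<Longrightarrow> p \<ge> 1 \<Longrightarrow> Y n p \<in> borel_measurable (M n p)"
    and "\<And>p. p \<ge> 1 \<Longrightarrow> prob_space (N p)"
    and "\<And>p. p \<ge> 1 \<Longrightarrow> X_lim p \<in> borel_measurable (N p)"
    and "bounded (c ` {1..})"
    and "tv_relatively_compact ((\<lambda>p. distr (N p) borel (X_lim p)) ` {1..})"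
    and "weak_conv_unif (\<lambda>n p. distr (M n p) borel (X n p)) (\<lambda>p. distr (N p) borel (X_lim p))"
    and "conv_in_prob_unif M Y c"
  shows "weak_conv_unif
           (\<lambda>n p. distr (M n p) borel (\<lambda>\<omega>. X n p \<omega> + Y n p \<omega>))
           (\<lambda>p. distr (N p) borel (\<lambda>\<omega>. X_lim p \<omega> + c p)) \<and>
         weak_conv_unif
           (\<lambda>n p. distr (M n p) borel (\<lambda>\<omega>. X n p \<omega> * Y n p \<omega>))
           (\<lambda>p. distr (N p) borel (\<lambda>\<omega>. c p * X_lim p \<omega>)) \<and>
         ((INF p\<in>{1..}. \<bar>c p\<bar>) > 0 \<longrightarrow>
           (\<forall>d :: real. weak_conv_unif
             (\<lambda>n p. distr (M n p) borel (\<lambda>\<omega>. if Y n p \<omega> = 0 then d else X n p \<omega> / Y n p \<omega>))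
             (\<lambda>p. distr (N p) borel (\<lambda>\<omega>. X_lim p \<omega> / c p))))"
proof -
  note map = weak_conv_unif_continuous_map[OF assms(1-5,7-9)]
  obtain R where R: "\<And>p. p \<ge> 1 \<Longrightarrow> \<bar>c p\<bar> \<le> R"
    using assms(6) by (auto simp: bounded_iff)
  have cR: "y \<in> {- (R + 1)..R + 1}" if "p \<ge> 1" "\<bar>y - c p\<bar> \<le> 1" for p y
    using R[OF that(1)] that(2) by auto
  have sum: "weak_conv_unif
      (\<lambda>n p. distr (M n p) borel (\<lambda>\<omega>. X n p \<omega> + Y n p \<omega>))
      (\<lambda>p. distr (N p) borel (\<lambda>\<omega>. X_lim p \<omega> + c p))"
    by (rule map[where g="(+)" and S="{- (R + 1)..R + 1}" and \<rho>=1])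
      (use cR in \<open>auto simp: case_prod_beta intro!: continuous_intros simp del: atLeastAtMost_iff\<close>)
  have "weak_conv_unif
      (\<lambda>n p. distr (M n p) borel (\<lambda>\<omega>. X n p \<omega> * Y n p \<omega>))
      (\<lambda>p. distr (N p) borel (\<lambda>\<omega>. X_lim p \<omega> * c p))"
    by (rule map[where g="(*)" and S="{- (R + 1)..R + 1}" and \<rho>=1])
      (use cR in \<open>auto simp: case_prod_beta intro!: continuous_intros simp del: atLeastAtMost_iff\<close>)
  then have product: "weak_conv_unif
      (\<lambda>n p. distr (M n p) borel (\<lambda>\<omega>. X n p \<omega> * Y n p \<omega>))
      (\<lambda>p. distr (N p) borel (\<lambda>\<omega>. c p * X_lim p \<omega>))"
    by (simp add: mult.commute)
  have quotient: "weak_conv_unif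
      (\<lambda>n p. distr (M n p) borel (\<lambda>\<omega>. if Y n p \<omega> = 0 then d else X n p \<omega> / Y n p \<omega>))
      (\<lambda>p. distr (N p) borel (\<lambda>\<omega>. X_lim p \<omega> / c p))"
    if pos: "(INF p\<in>{1..}. \<bar>c p\<bar>) > 0" for d :: real
  proof -
    define m where "m = (INF p\<in>{1..}. \<bar>c p\<bar>)"
    have m: "m \<le> \<bar>c p\<bar>" if "p \<ge> 1" for p
      unfolding m_def using that by (intro cINF_lower bdd_belowI2[where m=0]) auto
    have "0 < m"
      using pos by (simp add: m_def)
    \<comment> \<open>Staying within \<open>m / 2\<close> of some \<open>c\<^sub>p\<close> keeps the denominator in this compact set away from \<open>0\<close>.\<close>
    define S where "S = {- (R + m)..- (m / 2)} \<union> {m / 2..R + m}"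
    have S: "y \<in> S" if "p \<ge> 1" "\<bar>y - c p\<bar> \<le> m / 2" for p y
      using R[OF that(1)] m[OF that(1)] that(2) \<open>0 < m\<close>
      unfolding S_def Un_iff atLeastAtMost_iff by linarith
    have "continuous_on (UNIV \<times> S) (\<lambda>z. fst z / snd z)"
      using \<open>0 < m\<close> by (intro continuous_intros) (auto simp: S_def)
    then have cont: "continuous_on (UNIV \<times> S) (\<lambda>(x, y). if y = 0 then d else x / y)"
      by (rule continuous_on_eq) (use \<open>0 < m\<close> in \<open>auto simp: S_def\<close>)
    have "weak_conv_unif
      (\<lambda>n p. distr (M n p) borel (\<lambda>\<omega>. if Y n p \<omega> = 0 then d else X n p \<omega> / Y n p \<omega>))
      (\<lambda>p. distr (N p) borel (\<lambda>\<omega>. if c p = 0 then d else X_lim p \<omega> / c p))"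
    proof (rule map[where S=S and \<rho>="m / 2"])
      show "compact S"
        by (auto simp: S_def intro: compact_Un)
    qed (use \<open>0 < m\<close> S cont in \<open>auto simp: case_prod_beta\<close>)
    moreover have "c p \<noteq> 0" if "p \<ge> 1" for p
      using m[OF that] \<open>0 < m\<close> by auto
    \<comment> \<open>The two limit laws can differ only at \<open>p = 0\<close>, where \<open>c\<^sub>p\<close> may vanish.\<close>
    ultimately show ?thesis
      using weak_conv_unif_cong_limit[where \<nu>="\<lambda>p. distr (N p) borel (\<lambda>\<omega>. X_lim p \<omega> / c p)"
          and \<nu>'="\<lambda>p. distr (N p) borel (\<lambda>\<omega>. if c p = 0 then d else X_lim p \<omega> / c p)"]
      by simp
  qed
  show ?thesis
    by (intro conjI impI allI) (fact sum, fact product, erule quotient)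
qed

end
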